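(* Let $(X,d)$ be a metric space, $\mu$ a Borel probability measure on $X$ and $T\colon X\to X$ a $\mu$-preserving transformation. Suppose $\mu$ satisfies condition (A). Let $(B_i)_{i\ge0}$ be balls in $X$ such that, for some $\beta>0$ and $\gamma>1$, \[ \sum_{i=0}^{n-1}\mu(B_i)\ge(\log n)^{\beta}(\log\log n)(\log\log\log n)^{\gamma}\quad\text{for all sufficiently large } n. \] Suppose $(T,X,\mu,d)$ has $\beta^{-1}$-exponential decay of correlations. Then, setting \[ \Delta_n(x)=\frac{\sum_{i=0}^{n-1}1_{B_i}(T^ix)}{\sum_{i=0}^{n-1}\mu(B_i)}, \] one has $\Delta_n(x)\to1$ as $n\to\infty$ for $\mu$-a.e. $x\in X$. Moreover, for every $\epsilon>0$ there exists $C>0$ such that for all sufficiently large $n$ \[ \mu(|\Delta_n-1|>\epsilon)\le C(\log\log n)^{-1}(\log\log\log n)^{-\gamma}. \]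
   Context: Condition (A): there exist $C>0$, $0<\delta<2$ and $r_0>0$ such that for all $x_0\in X$, $0<r\le r_0$ and $0<\epsilon\le1$, $\mu(\{x: r<d(x,x_0)<r+\epsilon\})<C\epsilon^{\delta}$. Convention: if the $B_i=B(x_0,r_i)$ are nested balls with $r_i\to0$, all centered at one given point $x_0$, then this inequality is only required for that point $x_0$. For $s>0$, $(T,X,\mu,d)$ has $s$-exponential decay of correlations if there are constants $C,\alpha>0$ such that for all Lipschitz functions $\varphi,\psi\colon X\to\mathbb{R}$ and all $n\ge1$, $\left|\int\varphi\circ T^n\,\psi\,d\mu-\int\varphi\,d\mu\int\psi\,d\mu\right|\le c(n)\|\varphi\|_{\mathrm{Lip}}\|\psi\|_{\mathrm{Lip}}$ with $c(n)\le Ce^{-\alpha n^{s}}$, where $\|\cdot\|_{\mathrm{Lip}}$ is the usual Lipschitz norm (supremum norm plus least Lipschitz constant).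
   Formalization: Unless the balls are nested around one point with radii tending to 0, all but finitely many radii are assumed to be at most an r_0 for which condition (A) holds; without this the statement is false, since (A) says nothing about larger balls. *)

theory Defs
  imports "HOL-Probability.Probability"
begin

text \<open>
  The annulus condition at scales up to \<open>r0\<close>, for all centres in \<open>S\<close>. The scale \<open>r0\<close> is a
  parameter because it is compared with the radii of the balls below.
\<close>

definition condition_A :: "'a::metric_space measure \<Rightarrow> 'a set \<Rightarrow> real \<Rightarrow> bool" where
  "condition_A M S r0 \<longleftrightarrow> r0 > 0 \<and>
     (\<exists>C>0. \<exists>\<delta>. 0 < \<delta> \<and> \<delta> < 2 \<and>
        (\<forall>x0\<in>S. \<forall>r \<epsilon>. 0 < r \<and> r \<le> r0 \<and> 0 < \<epsilon> \<and> \<epsilon> \<le> 1 \<longrightarrow>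
           measure M {x. r < dist x x0 \<and> dist x x0 < r + \<epsilon>} < C * \<epsilon> powr \<delta>))"

text \<open>
  The annulus condition for the balls \<open>B(c i, r i)\<close>. In general it is required at every centre.
  For nested balls around one point \<open>x0\<close> with radii tending to 0 it is required at \<open>x0\<close> only.
  In the first case all but finitely many radii must lie in the range \<open>(0, r0]\<close> that the
  annulus condition controls. In the second case this follows from \<open>r i \<longlonglongrightarrow> 0\<close>.
\<close>

definition condition_A_balls ::
    "'a::metric_space measure \<Rightarrow> (nat \<Rightarrow> 'a) \<Rightarrow> (nat \<Rightarrow> real) \<Rightarrow> bool" where
  "condition_A_balls M c r \<longleftrightarrow>
     (\<exists>r0. condition_A M UNIV r0 \<and> (\<forall>\<^sub>F i in sequentially. r i \<le> r0)) \<or>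
     (\<exists>x0 r0. (\<forall>i. c i = x0) \<and> decseq (\<lambda>i. ball x0 (r i)) \<and> r \<longlonglongrightarrow> 0 \<and> condition_A M {x0} r0)"

definition bounded_lipschitz :: "('a::metric_space \<Rightarrow> real) \<Rightarrow> bool" where
  "bounded_lipschitz \<phi> \<longleftrightarrow> bounded (range \<phi>) \<and> (\<exists>L. L-lipschitz_on UNIV \<phi>)"

definition lip_norm :: "('a::metric_space \<Rightarrow> real) \<Rightarrow> real" where
  "lip_norm \<phi> = (SUP x. \<bar>\<phi> x\<bar>) + Inf {L. L-lipschitz_on UNIV \<phi>}"

text \<open>
  Only bounded Lipschitz observables are tested: for an unbounded one the Lipschitz norm is
  infinite and the inequality carries no information.
\<close>

definition exp_decay_of_correlations ::
    "real \<Rightarrow> ('a::metric_space \<Rightarrow> 'a) \<Rightarrow> 'a measure \<Rightarrow> bool" where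
  "exp_decay_of_correlations s T M \<longleftrightarrow>
     (\<exists>C>0. \<exists>\<alpha>>0. \<exists>c::nat \<Rightarrow> real.
        (\<forall>n\<ge>1. c n \<le> C * exp (- \<alpha> * real n powr s)) \<and>
        (\<forall>\<phi> \<psi>. bounded_lipschitz \<phi> \<longrightarrow> bounded_lipschitz \<psi> \<longrightarrow>
           (\<forall>n\<ge>1. \<bar>(\<integral>x. \<phi> ((T ^^ n) x) * \<psi> x \<partial>M) - (\<integral>x. \<phi> x \<partial>M) * (\<integral>x. \<psi> x \<partial>M)\<bar>
                    \<le> c n * lip_norm \<phi> * lip_norm \<psi>)))"

definition hit_ratio ::
    "'a measure \<Rightarrow> ('a \<Rightarrow> 'a) \<Rightarrow> (nat \<Rightarrow> 'a set) \<Rightarrow> nat \<Rightarrow> 'a \<Rightarrow> real" where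
  "hit_ratio M T B n x =
     (\<Sum>i<n. indicator (B i) ((T ^^ i) x)) / (\<Sum>i<n. measure M (B i))"

end

theory Submission
  imports Defs
begin

text \<open>
  Write \<open>E n\<close> for the sum of the measures of the first \<open>n\<close> balls. Only upper bounds on covariances
  matter, so each indicator is replaced by a Lipschitz function that dominates it. By the annulus
  condition and the decay of correlations, with a width exponentially small in \<open>(j - i) powr (1 / \<beta>)\<close>,
  the covariance of the hits at times \<open>i < j\<close> is at most \<open>D * exp (- \<kappa> * (j - i) powr (1 / \<beta>))\<close>.
  It is also at most the measure of the \<open>j\<close>-th ball. Using the second bound for \<open>j - i\<close> up to a
  multiple of \<open>ln n powr \<beta>\<close> and the first one beyond, the variance of the hit count is at most a
  constant times \<open>ln n powr \<beta> * E n\<close>, and the deviation estimate is Chebyshev's inequality.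

  For almost sure convergence let \<open>N k\<close> be the first time at which \<open>E\<close> reaches \<open>q ^ k\<close>, where \<open>q > 1\<close>.
  Either \<open>ln (N k) powr \<beta> \<le> q powr (k / 2)\<close>, or \<open>ln (ln (N k))\<close> is at least linear in \<open>k\<close>. So the
  deviation probabilities at the times \<open>N k\<close> are bounded by a geometric series plus a multiple of the
  series of \<open>1 / (k * ln k powr \<gamma>)\<close>, and Borel--Cantelli applies. Monotonicity of the hit counts
  fills the gaps between the times \<open>N k\<close> up to a factor close to \<open>q\<close>.
\<close>

section \<open>Covariances of hits\<close>

definition cutoff :: "'a::metric_space \<Rightarrow> real \<Rightarrow> real \<Rightarrow> 'a \<Rightarrow> real" where
  "cutoff c r \<epsilon> x = max 0 (min 1 (1 - (dist x c - r) / \<epsilon>))"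

lemma cutoff_nonneg [simp]: "0 \<le> cutoff c r \<epsilon> x"
  and cutoff_le_1 [simp]: "cutoff c r \<epsilon> x \<le> 1"
  by (auto simp: cutoff_def)

lemma indicator_ball_le_cutoff: "\<epsilon> > 0 \<Longrightarrow> indicator (ball c r) x \<le> cutoff c r \<epsilon> x"
  by (auto simp: cutoff_def indicator_def dist_commute divide_simps)

lemma cutoff_lipschitz:
  assumes "\<epsilon> > 0"
  shows "(1 / \<epsilon>)-lipschitz_on UNIV (cutoff c r \<epsilon>)"
proof (rule lipschitz_onI)
  fix x y
  have "dist (cutoff c r \<epsilon> x) (cutoff c r \<epsilon> y) \<le> \<bar>(dist x c - r) / \<epsilon> - (dist y c - r) / \<epsilon>\<bar>"
    by (auto simp: cutoff_def dist_real_def max_def min_def)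
  also have "\<dots> = \<bar>dist x c - dist y c\<bar> / \<epsilon>"
    using assms by (simp flip: diff_divide_distrib)
  also have "\<dots> \<le> 1 / \<epsilon> * dist x y"
    using assms abs_dist_diff_le[of x c y] by (simp add: divide_right_mono dist_commute)
  finally show "dist (cutoff c r \<epsilon> x) (cutoff c r \<epsilon> y) \<le> 1 / \<epsilon> * dist x y" .
qed (use assms in simp)

lemma bounded_lipschitz_cutoff: "\<epsilon> > 0 \<Longrightarrow> bounded_lipschitz (cutoff c r \<epsilon>)"
  unfolding bounded_lipschitz_def bounded_iff using cutoff_lipschitz[of \<epsilon> c r]
  by (intro conjI exI[of _ 1] exI[of _ "1 / \<epsilon>"]) auto

text \<open>Supremum and infimum are taken in the reals, so boundedness and the existence of a
  Lipschitz constant are what make both summands nonnegative. The sign is needed to enlarge the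
  decay rate in front of a product of two norms.\<close>

lemma lip_norm_nonneg:
  assumes "bounded_lipschitz \<phi>"
  shows "0 \<le> lip_norm \<phi>"
proof -
  obtain K where K: "\<And>x. \<bar>\<phi> x\<bar> \<le> K"
    using assms unfolding bounded_lipschitz_def bounded_iff by auto
  have "0 \<le> (SUP x. \<bar>\<phi> x\<bar>)"
    by (rule cSUP_upper2[of _ _ undefined]) (use K in \<open>auto intro!: bdd_aboveI2\<close>)
  moreover have "0 \<le> Inf {L. L-lipschitz_on UNIV \<phi>}"
    using assms by (intro cInf_greatest) (auto simp: bounded_lipschitz_def intro: lipschitz_on_nonneg)
  ultimately show ?thesis by (simp add: lip_norm_def)
qed

lemma lip_norm_le:
  assumes "\<And>x. \<bar>\<phi> x\<bar> \<le> K" "L-lipschitz_on UNIV \<phi>"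
  shows "lip_norm \<phi> \<le> K + L"
  unfolding lip_norm_def
proof (rule add_mono)
  show "(SUP x. \<bar>\<phi> x\<bar>) \<le> K" by (rule cSUP_least) (use assms in auto)
  show "Inf {L. L-lipschitz_on UNIV \<phi>} \<le> L"
    by (rule cInf_lower) (use assms in \<open>auto intro!: bdd_belowI[of _ 0] dest: lipschitz_on_nonneg\<close>)
qed

lemma cutoff_measurable [measurable]: "cutoff c r \<epsilon> \<in> borel_measurable borel"
  unfolding cutoff_def[abs_def] divide_inverse
  by (intro borel_measurable_continuous_onI continuous_intros)

section \<open>The annulus condition and joint hits of two balls\<close>

definition thin_annuli :: "'a::metric_space measure \<Rightarrow> real \<Rightarrow> real \<Rightarrow> 'a \<Rightarrow> real \<Rightarrow> bool" where
  "thin_annuli M C \<delta> c r \<longleftrightarrow> (\<forall>\<rho> \<epsilon>. 0 < \<rho> \<and> \<rho> \<le> r \<and> 0 < \<epsilon> \<and> \<epsilon> \<le> 1 \<longrightarrow>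
     measure M {x. \<rho> < dist x c \<and> dist x c < \<rho> + \<epsilon>} \<le> C * \<epsilon> powr \<delta>)"

text \<open>Both alternatives of \<open>condition_A_balls\<close> become one annulus condition over
  a set \<open>S\<close> of centres, with \<open>S = UNIV\<close> or \<open>S = {x0}\<close>. From
  some index \<open>N\<close> on, the radii stay within its scale, so the constants are uniform in
  \<open>i\<close>.\<close>

lemma condition_A_balls_imp_thin_annuli:
  assumes "condition_A_balls M c r"
  shows "\<exists>C>0. \<exists>\<delta>>0. \<exists>N. \<forall>i\<ge>N. thin_annuli M C \<delta> (c i) (r i)"
proof -
  have "\<exists>S r0. condition_A M S r0 \<and> (\<forall>\<^sub>F i in sequentially. c i \<in> S \<and> r i \<le> r0)"
    using assms unfolding condition_A_balls_def
  proof (elim disjE exE conjE)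
    fix r0 assume "condition_A M UNIV r0" "\<forall>\<^sub>F i in sequentially. r i \<le> r0"
    then show ?thesis by (intro exI[of _ UNIV] exI[of _ r0]) auto
  next
    fix x0 r0 assume *: "\<forall>i. c i = x0" "r \<longlonglongrightarrow> 0" "condition_A M {x0} r0"
    then have "\<forall>\<^sub>F i in sequentially. r i < r0"
      by (intro order_tendstoD) (auto simp: condition_A_def)
    with * show ?thesis by (intro exI[of _ "{x0}"] exI[of _ r0]) (auto elim: eventually_mono)
  qed
  then obtain S r0 N where S: "condition_A M S r0" "\<And>i. N \<le> i \<Longrightarrow> c i \<in> S \<and> r i \<le> r0"
    unfolding eventually_sequentially by metis
  then obtain C \<delta> where C: "C > 0" "\<delta> > 0"
     "\<And>x0 r \<epsilon>. x0 \<in> S \<Longrightarrow> 0 < r \<Longrightarrow> r \<le> r0 \<Longrightarrow> 0 < \<epsilon> \<Longrightarrow> \<epsilon> \<le> 1 \<Longrightarrow>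
           measure M {x. r < dist x x0 \<and> dist x x0 < r + \<epsilon>} < C * \<epsilon> powr \<delta>"
    unfolding condition_A_def by blast
  have "thin_annuli M C \<delta> (c i) (r i)" if "N \<le> i" for i
    using C(3) S(2)[OF that] unfolding thin_annuli_def by (meson less_imp_le order_trans)
  with C(1,2) show ?thesis by blast
qed

lemma (in prob_space) integrable_bounded_by_1:
  fixes f :: "'a \<Rightarrow> real"
  assumes "f \<in> borel_measurable M" "\<And>x. \<bar>f x\<bar> \<le> 1"
  shows "integrable M f"
  by (rule integrable_const_bound[of _ 1]) (use assms in auto)

text \<open>The cutoff exceeds the indicator only on the shell
  \<open>r \<le> dist x c < r + \<epsilon>\<close>. This shell fits into an annulus of width
  \<open>2 * \<epsilon>\<close>, and \<open>\<epsilon> \<le> 1/2\<close> keeps that width within the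
  admissible range.\<close>

lemma integral_cutoff_le:
  fixes M :: "'a::metric_space measure"
  assumes "prob_space M" and [measurable_cong]: "sets M = sets borel"
    and "thin_annuli M C \<delta> c r" "r > 0" "0 < \<epsilon>" "\<epsilon> \<le> 1/2"
  shows "(\<integral>x. cutoff c r \<epsilon> x \<partial>M) \<le> measure M (ball c r) + C * (2 * \<epsilon>) powr \<delta>"
proof -
  interpret prob_space M by fact
  \<comment> \<open>The annulus starts strictly inside the ball so that it contains the sphere of radius \<open>r\<close>.\<close>
  define \<rho> where "\<rho> = r - min (r / 2) \<epsilon>"
  have \<rho>: "0 < \<rho>" "\<rho> < r" "r \<le> \<rho> + \<epsilon>" using assms by (auto simp: \<rho>_def min_def)
  define R where "R = {x. \<rho> < dist x c \<and> dist x c < \<rho> + 2 * \<epsilon>}"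
  have [measurable]: "R \<in> sets borel"
    unfolding R_def by (intro borel_open open_Collect_conj open_Collect_less continuous_intros)
  have sets [simp]: "R \<in> events" "ball c r \<in> events" by measurable
  have sp: "space M = UNIV" using assms(2) by (metis sets_eq_imp_space_eq space_borel)
  have "expectation (cutoff c r \<epsilon>) \<le> expectation (\<lambda>x. indicator (ball c r) x + indicator R x)"
  proof (rule integral_mono)
    show "integrable M (cutoff c r \<epsilon>)" by (rule integrable_bounded_by_1) auto
    show "integrable M (\<lambda>x. indicator (ball c r) x + indicator R x :: real)"
      by (intro Bochner_Integration.integrable_add integrable_real_indicator) (auto simp: less_top[symmetric])
    fix x
    show "cutoff c r \<epsilon> x \<le> indicator (ball c r) x + indicator R x"
      using \<rho> assms(5)
      by (auto simp: cutoff_def indicator_def R_def dist_commute divide_simps)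
  qed
  also have "\<dots> = prob (ball c r) + prob R"
    using sets by (subst Bochner_Integration.integral_add) (auto intro!: integrable_real_indicator simp: sp less_top[symmetric])
  also have "prob R \<le> C * (2 * \<epsilon>) powr \<delta>"
    using assms(3)[unfolded thin_annuli_def, rule_format, of \<rho> "2 * \<epsilon>"] \<rho> assms by (auto simp: R_def)
  finally show ?thesis by simp
qed

text \<open>Both indicators are replaced by cutoffs, whose Lipschitz norms are at most
  \<open>1 + 1 / \<epsilon>\<close>. Returning from the integrals of the cutoffs to the measures of
  the balls costs one annulus error for each ball. The rate \<open>q\<close> may have any sign,
  hence the separate nonnegative bound \<open>q'\<close>.\<close>

lemma integral_hit_both_le:
  fixes M :: "'a::metric_space measure"
  assumes M: "prob_space M" and sets [measurable_cong]: "sets M = sets borel"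
    and [measurable]: "U \<in> measurable M M"
    and A: "thin_annuli M C \<delta> c1 r1" "thin_annuli M C \<delta> c2 r2"
    and r: "r1 > 0" "r2 > 0" and \<epsilon>: "0 < \<epsilon>" "\<epsilon> \<le> 1/2"
    and decay: "\<And>\<phi> \<psi>. bounded_lipschitz \<phi> \<Longrightarrow> bounded_lipschitz \<psi> \<Longrightarrow>
      \<bar>(\<integral>x. \<phi> (U x) * \<psi> x \<partial>M) - (\<integral>x. \<phi> x \<partial>M) * (\<integral>x. \<psi> x \<partial>M)\<bar>
        \<le> q * lip_norm \<phi> * lip_norm \<psi>"
    and q: "q \<le> q'" "0 \<le> q'"
  shows "(\<integral>x. indicator (ball c1 r1) x * indicator (ball c2 r2) (U x) \<partial>M)
    \<le> measure M (ball c1 r1) * measure M (ball c2 r2) + 2 * (C * (2 * \<epsilon>) powr \<delta>) + q' * (1 + 1 / \<epsilon>)\<^sup>2"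
proof -
  interpret prob_space M by fact
  define f g where "f = cutoff c1 r1 \<epsilon>" and "g = cutoff c2 r2 \<epsilon>"
  define a where "a = C * (2 * \<epsilon>) powr \<delta>"
  have [measurable]: "f \<in> borel_measurable M" "g \<in> borel_measurable M" by (auto simp: f_def g_def)
  have [measurable]: "ball c1 r1 \<in> events" "ball c2 r2 \<in> events" by measurable
  have fg: "0 \<le> f x" "f x \<le> 1" "0 \<le> g x" "g x \<le> 1" for x by (auto simp: f_def g_def)
  have intf: "integrable M f" "integrable M g"
    using fg by (auto intro!: integrable_bounded_by_1)
  have L: "bounded_lipschitz f" "bounded_lipschitz g"
    using \<epsilon> by (auto simp: f_def g_def bounded_lipschitz_cutoff)
  have N: "lip_norm f \<le> 1 + 1 / \<epsilon>" "lip_norm g \<le> 1 + 1 / \<epsilon>"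
    using \<epsilon> by (auto simp: f_def g_def intro!: lip_norm_le cutoff_lipschitz)
  have "expectation (\<lambda>x. indicator (ball c1 r1) x * indicator (ball c2 r2) (U x))
      \<le> expectation (\<lambda>x. g (U x) * f x)"
  proof (rule integral_mono)
    show "integrable M (\<lambda>x. indicator (ball c1 r1) x * indicator (ball c2 r2) (U x) :: real)"
      by (rule integrable_bounded_by_1) (measurable, auto simp: indicator_def)
    show "integrable M (\<lambda>x. g (U x) * f x)"
      using fg by (intro integrable_bounded_by_1) (auto simp: abs_mult mult_le_one)
    fix x
    show "indicator (ball c1 r1) x * indicator (ball c2 r2) (U x) \<le> g (U x) * f x"
      unfolding f_def g_def using \<epsilon>
      by (subst mult.commute) (intro mult_mono indicator_ball_le_cutoff, auto)
  qed
  also have "\<dots> \<le> expectation g * expectation f + q * lip_norm g * lip_norm f"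
    using decay[OF L(2) L(1)] by linarith
  also have "q * lip_norm g * lip_norm f \<le> q' * (1 + 1 / \<epsilon>) * (1 + 1 / \<epsilon>)"
  proof -
    have "q * (lip_norm g * lip_norm f) \<le> q' * (lip_norm g * lip_norm f)"
      using q lip_norm_nonneg[OF L(1)] lip_norm_nonneg[OF L(2)] by (intro mult_right_mono) auto
    also have "\<dots> \<le> q' * ((1 + 1 / \<epsilon>) * (1 + 1 / \<epsilon>))"
      using q N lip_norm_nonneg[OF L(1)] lip_norm_nonneg[OF L(2)] \<epsilon> by (intro mult_left_mono mult_mono) auto
    finally show ?thesis by (simp add: mult.assoc)
  qed
  also have "expectation g * expectation f \<le> prob (ball c1 r1) * prob (ball c2 r2) + 2 * a"
  proof -
    have Ef: "expectation f \<le> prob (ball c1 r1) + a" "expectation g \<le> prob (ball c2 r2) + a"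
      unfolding f_def g_def a_def using M sets A r \<epsilon> by (auto intro!: integral_cutoff_le)
    have g1: "expectation g \<le> 1" "0 \<le> expectation g"
      using integral_le_const[OF intf(2), of 1] fg by (auto simp: integral_nonneg)
    \<comment> \<open>The sign of \<open>C\<close> is not among the assumptions, so it is read off
      from the measure of an annulus.\<close>
    have "0 \<le> a"
    proof -
      have "0 \<le> measure M {x. r1 < dist x c1 \<and> dist x c1 < r1 + 2 * \<epsilon>}" by simp
      also have "\<dots> \<le> a" unfolding a_def using A(1) r \<epsilon> by (auto simp: thin_annuli_def)
      finally show ?thesis .
    qed
    have "expectation g * expectation f \<le> expectation g * (prob (ball c1 r1) + a)"
      using Ef g1 by (intro mult_left_mono)
    also have "\<dots> = expectation g * prob (ball c1 r1) + expectation g * a"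
      by (simp add: algebra_simps)
    also have "\<dots> \<le> (prob (ball c2 r2) + a) * prob (ball c1 r1) + 1 * a"
      using Ef g1 \<open>0 \<le> a\<close> by (intro add_mono mult_right_mono) auto
    also have "\<dots> \<le> prob (ball c1 r1) * prob (ball c2 r2) + 2 * a"
      using mult_left_mono[OF prob_le_1[of "ball c1 r1"] \<open>0 \<le> a\<close>] by (simp add: algebra_simps)
    finally show ?thesis .
  qed
  finally show ?thesis by (simp add: a_def power2_eq_square mult.assoc)
qed

section \<open>Joint hits along an orbit and the variance of the hit count\<close>

lemma integral_iterate_invariant:
  fixes f :: "'a \<Rightarrow> real"
  assumes "T \<in> measurable M M" "distr M M T = M" and [measurable]: "f \<in> borel_measurable M"
  shows "(\<integral>x. f ((T ^^ i) x) \<partial>M) = (\<integral>x. f x \<partial>M)"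
proof (induction i)
  case (Suc i)
  have [measurable]: "(T ^^ i) \<in> measurable M M"
    using assms(1) by (rule measurable_compose_n)
  have "(\<integral>x. f ((T ^^ i) (T x)) \<partial>M) = (\<integral>x. f ((T ^^ i) x) \<partial>distr M M T)"
    using assms(1) by (intro integral_distr[symmetric]) auto
  then show ?case using Suc assms(2) by (simp add: funpow_swap1)
qed simp

lemma sum_square_symmetric:
  fixes g :: "nat \<Rightarrow> nat \<Rightarrow> real"
  assumes "\<And>i j. g i j = g j i"
  shows "(\<Sum>i<n. \<Sum>j<n. g i j) = (\<Sum>j<n. g j j) + 2 * (\<Sum>j<n. \<Sum>i<j. g i j)"
proof (induction n)
  case (Suc n)
  have "(\<Sum>j<n. g n j) = (\<Sum>i<n. g i n)" using assms by simp
  with Suc show ?case by (simp add: sum.distrib)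
qed simp

text \<open>The width of the cutoffs is free: shrinking it lowers the annulus error and raises the
  Lipschitz norms. A width exponentially small in \<open>n powr s\<close> makes both errors
  exponentially small, with constants that depend on neither the balls nor \<open>n\<close>.\<close>

lemma integral_hit_both_decay:
  fixes M :: "'a::metric_space measure"
  assumes M: "prob_space M" and sets: "sets M = sets borel"
    and T: "T \<in> measurable M M"
    and decay: "exp_decay_of_correlations s T M"
    and C: "C > 0" "\<delta> > 0"
  shows "\<exists>D>0. \<exists>\<kappa>>0. \<forall>c1 r1 c2 r2. \<forall>n\<ge>1.
    thin_annuli M C \<delta> c1 r1 \<longrightarrow> thin_annuli M C \<delta> c2 r2 \<longrightarrow> r1 > 0 \<longrightarrow> r2 > 0 \<longrightarrow>
      (\<integral>x. indicator (ball c1 r1) x * indicator (ball c2 r2) ((T ^^ n) x) \<partial>M)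
        \<le> measure M (ball c1 r1) * measure M (ball c2 r2) + D * exp (- \<kappa> * real n powr s)"
proof -
  obtain C' \<alpha> q where d: "C' > 0" "\<alpha> > 0" "\<And>n::nat. n \<ge> 1 \<Longrightarrow> q n \<le> C' * exp (- \<alpha> * real n powr s)"
    "\<And>\<phi> \<psi> n. bounded_lipschitz \<phi> \<Longrightarrow> bounded_lipschitz \<psi> \<Longrightarrow> n \<ge> 1 \<Longrightarrow>
       \<bar>(\<integral>x. \<phi> ((T ^^ n) x) * \<psi> x \<partial>M) - (\<integral>x. \<phi> x \<partial>M) * (\<integral>x. \<psi> x \<partial>M)\<bar>
                    \<le> q n * lip_norm \<phi> * lip_norm \<psi>"
    using decay unfolding exp_decay_of_correlations_def by blast
  \<comment> \<open>The rate \<open>\<alpha> / 2\<close> is left over from the correlation error and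
    \<open>\<alpha> * \<delta> / 4\<close> from the annulus error. In \<open>D\<close>, the term
    \<open>2 * C\<close> counts two annulus errors, and 16 is the prefactor of
    \<open>(2 / \<epsilon>)^2\<close>.\<close>
  define \<kappa> where "\<kappa> = min (\<alpha> / 2) (\<alpha> * \<delta> / 4)"
  define D where "D = 2 * C + 16 * C'"
  have D0: "D > 0" and \<kappa>0: "\<kappa> > 0" using C d by (auto simp: D_def \<kappa>_def)
  have main: "(\<integral>x. indicator (ball c1 r1) x * indicator (ball c2 r2) ((T ^^ n) x) \<partial>M)
        \<le> measure M (ball c1 r1) * measure M (ball c2 r2) + D * exp (- \<kappa> * real n powr s)"
    if *: "thin_annuli M C \<delta> c1 r1" "thin_annuli M C \<delta> c2 r2" "r1 > 0" "r2 > 0" "n \<ge> 1"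
    for c1 r1 c2 r2 and n :: nat
  proof -
    define t where "t = real n powr s"
    have t: "t \<ge> 0" by (simp add: t_def)
    \<comment> \<open>The rate \<open>\<alpha> / 4\<close> leaves \<open>exp (- \<alpha> / 2 * t)\<close> after the squared Lipschitz norm of order \<open>1 / \<epsilon>\<^sup>2\<close> is paid for.\<close>
    define \<epsilon> where "\<epsilon> = exp (- (\<alpha> / 4) * t) / 2"
    have "exp (- (\<alpha> / 4) * t) \<le> 1" using d t by simp
    then have \<epsilon>: "0 < \<epsilon>" "\<epsilon> \<le> 1/2" by (auto simp: \<epsilon>_def)
    have \<kappa>: "\<kappa> * t \<le> \<alpha> / 2 * t" "\<kappa> * t \<le> \<alpha> * \<delta> / 4 * t"
      using t by (auto simp only: \<kappa>_def intro!: mult_right_mono min.cobounded1 min.cobounded2)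
    have "C * (2 * \<epsilon>) powr \<delta> = C * exp (- (\<alpha> * \<delta> / 4) * t)"
      by (simp add: \<epsilon>_def powr_def algebra_simps)
    also have "\<dots> \<le> C * exp (- \<kappa> * t)"
      using C \<kappa>(2) by simp
    finally have 1: "C * (2 * \<epsilon>) powr \<delta> \<le> C * exp (- \<kappa> * t)" .
    have "1 + 1 / \<epsilon> \<le> 2 / \<epsilon>" using \<epsilon> by (simp add: field_simps)
    then have "(1 + 1 / \<epsilon>)\<^sup>2 \<le> (2 / \<epsilon>)\<^sup>2" using \<epsilon> by (intro power_mono) auto
    also have "\<dots> = 16 * exp (\<alpha> / 2 * t)"
    proof -
      have "2 / \<epsilon> = 4 * exp (\<alpha> / 4 * t)" by (simp add: \<epsilon>_def exp_minus field_simps)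
      then show ?thesis by (simp add: power_mult_distrib flip: exp_double)
    qed
    finally have "C' * exp (- \<alpha> * t) * (1 + 1 / \<epsilon>)\<^sup>2 \<le> C' * exp (- \<alpha> * t) * (16 * exp (\<alpha> / 2 * t))"
      using d by (intro mult_left_mono) auto
    also have "\<dots> = 16 * C' * exp (- (\<alpha> / 2) * t)"
      by (simp add: mult_exp_exp)
    also have "\<dots> \<le> 16 * C' * exp (- \<kappa> * t)"
      using d \<kappa>(1) by simp
    finally have 2: "C' * exp (- \<alpha> * t) * (1 + 1 / \<epsilon>)\<^sup>2 \<le> 16 * C' * exp (- \<kappa> * t)" .
    have "(\<integral>x. indicator (ball c1 r1) x * indicator (ball c2 r2) ((T ^^ n) x) \<partial>M)
      \<le> measure M (ball c1 r1) * measure M (ball c2 r2)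
         + 2 * (C * (2 * \<epsilon>) powr \<delta>) + C' * exp (- \<alpha> * t) * (1 + 1 / \<epsilon>)\<^sup>2"
    proof (rule integral_hit_both_le[OF M sets])
      show "(T ^^ n) \<in> measurable M M" using T by (rule measurable_compose_n)
    qed (use * \<epsilon> d in \<open>auto simp: t_def\<close>)
    with 1 2 show ?thesis
      by (simp add: D_def t_def algebra_simps)
  qed
  show ?thesis using D0 \<kappa>0 main by blast
qed

text \<open>Covariances are grouped by the later index \<open>j\<close>. The earlier indices below
  \<open>N\<close>, where no annulus bound is available, and those close to \<open>j\<close> each
  contribute at most \<open>\<mu> j\<close>. The remaining ones contribute \<open>O(1 / n)\<close>
  per column, hence a bounded amount in total, which the divergent sum absorbs.\<close>

lemma variance_hits_le:
  fixes M :: "'a::metric_space measure" and c :: "nat \<Rightarrow> 'a"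
  assumes M: "prob_space M" and sets [measurable_cong]: "sets M = sets borel"
    and T [measurable]: "T \<in> measurable M M" and inv: "distr M M T = M"
    and r: "\<And>i. r i > 0" and B: "\<And>i. B i = ball (c i) (r i)"
    and A: "condition_A_balls M c r" and "\<beta> > 0"
    and decay: "exp_decay_of_correlations (1 / \<beta>) T M"
    and lim: "filterlim (\<lambda>n. \<Sum>i<n. measure M (B i)) at_top sequentially"
  obtains D where "D > 0" "\<forall>\<^sub>F n in sequentially.
    (\<integral>x. ((\<Sum>i<n. indicator (B i) ((T ^^ i) x)) - (\<Sum>i<n. measure M (B i)))\<^sup>2 \<partial>M)
      \<le> D * ln (real n) powr \<beta> * (\<Sum>i<n. measure M (B i))"
proof -
  interpret prob_space M by fact
  obtain C \<delta> N where thin: "C > 0" "\<delta> > 0" "\<And>i. N \<le> i \<Longrightarrow> thin_annuli M C \<delta> (c i) (r i)"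
    using condition_A_balls_imp_thin_annuli[OF A] by blast
  obtain D \<kappa> where D: "D > 0" "\<kappa> > 0" "\<And>c1 r1 c2 r2 n. \<lbrakk>thin_annuli M C \<delta> c1 r1; thin_annuli M C \<delta> c2 r2; r1 > 0; r2 > 0; n \<ge> 1\<rbrakk> \<Longrightarrow>
      (\<integral>x. indicator (ball c1 r1) x * indicator (ball c2 r2) ((T ^^ n) x) \<partial>M)
        \<le> measure M (ball c1 r1) * measure M (ball c2 r2) + D * exp (- \<kappa> * real n powr (1 / \<beta>))"
    using integral_hit_both_decay[OF M sets T decay thin(1,2)] by blast
  define X :: "nat \<Rightarrow> 'a \<Rightarrow> real" where "X i x = indicator (B i) ((T ^^ i) x)" for i x
  define \<mu> where "\<mu> i = measure M (B i)" for i
  define E where "E n = (\<Sum>i<n. \<mu> i)" for n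
  define cov where "cov i j = expectation (\<lambda>x. X i x * X j x) - \<mu> i * \<mu> j" for i j
  have B_sets [measurable]: "B i \<in> events" for i unfolding B sets by simp
  have iter [measurable]: "(T ^^ i) \<in> measurable M M" for i
    using T by (rule measurable_compose_n)
  have X_meas [measurable]: "X i \<in> borel_measurable M" for i unfolding X_def by measurable
  have X01: "0 \<le> X i x" "X i x \<le> 1" for i x by (auto simp: X_def indicator_def)
  have XX: "integrable M (\<lambda>x. X i x * X j x)" for i j
    using X01 by (intro integrable_bounded_by_1) (auto simp: abs_mult mult_le_one)
  have intX: "integrable M (X i)" for i
    using X01 by (intro integrable_bounded_by_1) auto
  have space: "space M = UNIV" using sets by (metis sets_eq_imp_space_eq space_borel)
  have EX: "expectation (X i) = \<mu> i" for i
    using integral_iterate_invariant[OF T inv, of "indicator (B i)" i]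
    by (simp add: X_def[abs_def] \<mu>_def space)
  have \<mu>0: "0 \<le> \<mu> i" for i by (simp add: \<mu>_def)
  have cov_sym: "cov i j = cov j i" for i j by (simp add: cov_def mult.commute)
  \<comment> \<open>The case \<open>i = j\<close> is included and later bounds the diagonal.\<close>
  have cov_le: "cov i j \<le> \<mu> j" for i j
  proof -
    have "expectation (\<lambda>x. X i x * X j x) \<le> expectation (X j)"
      using X01 by (intro integral_mono XX intX mult_left_le_one_le) auto
    then show ?thesis using EX[of j] mult_nonneg_nonneg[OF \<mu>0[of i] \<mu>0[of j]] by (simp add: cov_def)
  qed
  \<comment> \<open>Invariance removes the first \<open>i\<close> iterates, so only the lag
    \<open>j - i\<close> remains.\<close>
  have cov_decay: "cov i j \<le> D * exp (- \<kappa> * real (j - i) powr (1 / \<beta>))" if "N \<le> i" "i < j" for i j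
  proof -
    have "X i x * X j x = (\<lambda>x. indicator (B i) x * indicator (B j) ((T ^^ (j - i)) x)) ((T ^^ i) x)" for x
    proof -
      have "(T ^^ j) x = (T ^^ (j - i)) ((T ^^ i) x)"
        using that by (simp flip: funpow_add o_apply[of "T ^^ (j - i)" "T ^^ i"])
      then show ?thesis by (simp add: X_def)
    qed
    then have "expectation (\<lambda>x. X i x * X j x)
      = expectation (\<lambda>x. indicator (B i) x * indicator (B j) ((T ^^ (j - i)) x))"
      by (simp only:) (rule integral_iterate_invariant[OF T inv], measurable)
    also have "\<dots> \<le> \<mu> i * \<mu> j + D * exp (- \<kappa> * real (j - i) powr (1 / \<beta>))"
      unfolding \<mu>_def B using that r by (intro D thin) auto
    finally show ?thesis by (simp add: cov_def)
  qed
  have var: "expectation (\<lambda>x. ((\<Sum>i<n. X i x) - E n)\<^sup>2) = (\<Sum>j<n. cov j j) + 2 * (\<Sum>j<n. \<Sum>i<j. cov i j)" for n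
  proof -
    have sq: "(\<Sum>i<n. X i x)\<^sup>2 = (\<Sum>i<n. \<Sum>j<n. X i x * X j x)" for x
      by (simp add: power2_eq_square sum_product)
    have ES: "expectation (\<lambda>x. \<Sum>i<n. X i x) = E n"
      using intX by (simp add: EX E_def)
    have "expectation (\<lambda>x. ((\<Sum>i<n. X i x) - E n)\<^sup>2)
      = expectation (\<lambda>x. (\<Sum>i<n. X i x)\<^sup>2) - (E n)\<^sup>2"
      using variance_eq[of "\<lambda>x. \<Sum>i<n. X i x"] intX XX unfolding ES sq by simp
    also have "\<dots> = (\<Sum>i<n. \<Sum>j<n. cov i j)"
      unfolding sq using XX
      by (simp add: cov_def sum_subtractf E_def power2_eq_square sum_product)
    finally show ?thesis using sum_square_symmetric[of cov n] cov_sym by simp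
  qed
  \<comment> \<open>Chosen so that pairs at distance more than \<open>A * ln n powr \<beta>\<close> have covariance \<open>O(1 / n\<^sup>2)\<close>.\<close>
  define A where "A = (2 / \<kappa>) powr \<beta>"
  have A0: "A > 0" using D by (simp add: A_def)
  have main: "expectation (\<lambda>x. ((\<Sum>i<n. X i x) - E n)\<^sup>2) \<le> (1 + 2 * (real N + A + D)) * ln (real n) powr \<beta> * E n"
    if n: "n \<ge> 3" "E n \<ge> 1" for n
  proof -
    define L where "L = ln (real n) powr \<beta>"
    \<comment> \<open>The threshold 3 is the first integer above \<open>exp 1\<close>.\<close>
    have ln1: "ln (real n) \<ge> 1"
      using n exp_le ln_ge_iff[of "real n" 1] by auto
    then have L1: "L \<ge> 1" unfolding L_def using \<open>\<beta> > 0\<close> by (simp add: ge_one_powr_ge_zero)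
    have far: "D * exp (- \<kappa> * real m powr (1 / \<beta>)) \<le> D / (real n)\<^sup>2" if "real m > A * L" for m
    proof -
      have "(2 / \<kappa>) * ln (real n) = (A * L) powr (1 / \<beta>)"
        using \<open>\<beta> > 0\<close> D ln1 by (simp add: A_def L_def powr_mult powr_powr)
      also have "\<dots> \<le> real m powr (1 / \<beta>)"
        using that \<open>\<beta> > 0\<close> A0 L1 by (intro powr_mono2) auto
      finally have "- \<kappa> * real m powr (1 / \<beta>) \<le> - 2 * ln (real n)"
        using D by (simp add: field_simps)
      then have "exp (- \<kappa> * real m powr (1 / \<beta>)) \<le> exp (- 2 * ln (real n))" by simp
      also have "\<dots> = 1 / (real n)\<^sup>2"
        using n by (simp add: exp_minus exp_double field_simps)
      finally show ?thesis using mult_left_mono[of _ "1 / (real n)\<^sup>2" D] D(1) by simp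
    qed
    have col: "(\<Sum>i<j. cov i j) \<le> (real N + A * L) * \<mu> j + D / real n" if "j < n" for j
    proof -
      have "(\<Sum>i<j. cov i j) \<le> (\<Sum>i<j. (if i < N then \<mu> j else 0)
          + (if real (j - i) \<le> A * L then \<mu> j else 0) + D / (real n)\<^sup>2)"
      proof (rule sum_mono)
        fix i assume "i \<in> {..<j}"
        then show "cov i j \<le> (if i < N then \<mu> j else 0)
          + (if real (j - i) \<le> A * L then \<mu> j else 0) + D / (real n)\<^sup>2"
          using cov_le[of i j] cov_decay[of i j] far[of "j - i"] \<mu>0[of j] D
          by (smt (verit) lessThan_iff not_le divide_nonneg_nonneg zero_le_power2)
      qed
      also have "\<dots> = real (card {i\<in>{..<j}. i < N}) * \<mu> j
          + real (card {i\<in>{..<j}. real (j - i) \<le> A * L}) * \<mu> j + real j * (D / (real n)\<^sup>2)"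
        by (simp add: sum.distrib sum.If_cases Int_def cong: conj_cong)
      also have "\<dots> \<le> real N * \<mu> j + A * L * \<mu> j + D / real n"
      proof (intro add_mono mult_right_mono \<mu>0)
        show "real (card {i\<in>{..<j}. i < N}) \<le> real N"
          using card_mono[of "{..<N}" "{i\<in>{..<j}. i < N}"] by auto
        \<comment> \<open>The lags \<open>j - i\<close> are distinct positive integers not exceeding
          \<open>A * L\<close>.\<close>
        have "card {i\<in>{..<j}. real (j - i) \<le> A * L} \<le> card {1..nat \<lfloor>A * L\<rfloor>}"
        proof (rule card_inj_on_le[where f = "\<lambda>i. j - i"])
          show "(\<lambda>i. j - i) ` {i\<in>{..<j}. real (j - i) \<le> A * L} \<subseteq> {1..nat \<lfloor>A * L\<rfloor>}"
            by (auto simp: le_nat_iff le_floor_iff)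
        qed (auto simp: inj_on_def)
        also have "real (card {1..nat \<lfloor>A * L\<rfloor>}) \<le> A * L"
          using A0 L1 by simp
        finally show "real (card {i\<in>{..<j}. real (j - i) \<le> A * L}) \<le> A * L" by simp
        have "real j * D \<le> real n * D" using that D by simp
        then show "real j * (D / (real n)\<^sup>2) \<le> D / real n"
          using n by (simp add: power2_eq_square field_simps)
      qed
      finally show ?thesis by (simp add: algebra_simps)
    qed
    have "(\<Sum>j<n. \<Sum>i<j. cov i j) \<le> (\<Sum>j<n. (real N + A * L) * \<mu> j + D / real n)"
      using col by (intro sum_mono) auto
    also have "\<dots> = (real N + A * L) * E n + D"
      using n by (simp add: sum.distrib E_def sum_distrib_left)
    finally have off: "(\<Sum>j<n. \<Sum>i<j. cov i j) \<le> (real N + A * L) * E n + D" .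
    have diag: "(\<Sum>j<n. cov j j) \<le> E n"
      unfolding E_def by (intro sum_mono cov_le)
    \<comment> \<open>Every lower-order term is absorbed into \<open>L * E n\<close>: the diagonal
      gives the 1 in the final constant, and the three off-diagonal terms give
      \<open>2 * (real N + A + D)\<close>.\<close>
    have LE: "1 \<le> L * E n" "E n \<le> L * E n"
      using L1 n mult_mono[of 1 L 1 "E n"] mult_right_mono[of 1 L "E n"] by auto
    have "D * 1 \<le> D * (L * E n)" "real N * E n \<le> real N * (L * E n)"
      using LE D by (auto intro!: mult_left_mono)
    then show ?thesis
      unfolding var L_def[symmetric] using off diag LE by (simp add: algebra_simps)
  qed
  have "\<forall>\<^sub>F n in sequentially. E n \<ge> 1"
    using lim unfolding filterlim_at_top E_def \<mu>_def by auto
  then have "\<forall>\<^sub>F n in sequentially.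
    expectation (\<lambda>x. ((\<Sum>i<n. X i x) - E n)\<^sup>2) \<le> (1 + 2 * (real N + A + D)) * ln (real n) powr \<beta> * E n"
    using eventually_ge_at_top[of 3] by eventually_elim (rule main)
  then show thesis
    using A0 D by (intro that[of "1 + 2 * (real N + A + D)"]) (auto simp: X_def E_def \<mu>_def)
qed

section \<open>Almost sure convergence along a geometric scale\<close>

text \<open>Cauchy condensation turns the series into a multiple of the convergent series of
  \<open>real n powr (- \<gamma>)\<close>.\<close>

lemma summable_inverse_ln_powr:
  fixes \<gamma> :: real
  assumes "\<gamma> > 1"
  shows "summable (\<lambda>n. inverse (real n * ln (real n) powr \<gamma>))"
proof -
  \<comment> \<open>Truncating at 2 makes the terms decreasing from index 0 on, as condensation
    requires, and changes only finitely many of them.\<close>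
  define g where "g n = inverse (max 2 (real n) * ln (max 2 (real n)) powr \<gamma>)" for n
  have "summable (\<lambda>n. real n powr (- \<gamma>))"
    using assms by (subst summable_real_powr_iff) auto
  then have "summable (\<lambda>n. ln 2 powr (- \<gamma>) * real n powr (- \<gamma>))"
    by (rule summable_mult)
  also have "?this \<longleftrightarrow> summable (\<lambda>n. 2 ^ n * g (2 ^ n))"
  proof (intro summable_cong eventually_mono[OF eventually_gt_at_top[of 0]])
    fix n :: nat assume "n > 0"
    then have "(2::real) \<le> 2 ^ n" by (cases n) auto
    then have "max 2 (real (2 ^ n)) = 2 ^ n" by simp
    then have "2 ^ n * g (2 ^ n) = inverse (ln (2 ^ n) powr \<gamma>)"
      by (simp add: g_def)
    also have "\<dots> = ln 2 powr (- \<gamma>) * real n powr (- \<gamma>)"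
      by (simp add: ln_realpow powr_mult powr_minus)
    finally show "ln 2 powr (- \<gamma>) * real n powr (- \<gamma>) = 2 ^ n * g (2 ^ n)" by simp
  qed
  also have "\<dots> \<longleftrightarrow> summable g"
  proof (rule condensation_test[symmetric])
    show "g (Suc m) \<le> g m" for m
      unfolding g_def using assms
      by (intro le_imp_inverse_le mult_mono powr_mono2 mult_pos_pos ln_mono) (auto intro: less_le_trans[of 0 2])
  qed (auto simp: g_def)
  also have "\<dots> \<longleftrightarrow> summable (\<lambda>n. inverse (real n * ln (real n) powr \<gamma>))"
    by (intro summable_cong eventually_mono[OF eventually_ge_at_top[of 2]]) (auto simp: g_def max_def)
  finally show ?thesis .
qed

lemma filterlim_power_at_top:
  fixes q :: real
  assumes "q > 1"
  shows "filterlim (\<lambda>k. q ^ k) at_top sequentially"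
  using assms
  by (intro filterlim_at_infinity_imp_filterlim_at_top filterlim_realpow_sequentially_gt1 always_eventually) auto

section \<open>First passage times of a slowly divergent sequence\<close>

definition first_above :: "(nat \<Rightarrow> real) \<Rightarrow> real \<Rightarrow> nat" where
  "first_above E a = (LEAST n. a \<le> E n)"

text \<open>These are the properties of partial sums of probabilities with infinite total that the
  subsequence argument uses.\<close>

locale slowly_divergent =
  fixes E :: "nat \<Rightarrow> real"
  assumes E0: "E 0 = 0"
    and mono_E: "mono E"
    and E_Suc: "E (Suc n) \<le> E n + 1"
    and E_at_top: "filterlim E at_top sequentially"
begin

lemma first_above_ge: "a \<le> E (first_above E a)"
proof -
  have "\<exists>n. a \<le> E n"
    using E_at_top by (auto simp: filterlim_at_top eventually_sequentially)
  then show ?thesis unfolding first_above_def by (rule LeastI_ex)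
qed

text \<open>A Galois connection: \<open>first_above E\<close> is the lower adjoint of
  \<open>E\<close>.\<close>

lemma first_above_le_iff: "first_above E a \<le> n \<longleftrightarrow> a \<le> E n"
  using first_above_ge[of a] monoD[OF mono_E, of "first_above E a" n] Least_le[of "\<lambda>n. a \<le> E n" n]
  by (auto simp: first_above_def)

text \<open>Just before the first passage the value is below \<open>a\<close>, and a single
  increment adds at most 1.\<close>

lemma E_first_above_le:
  assumes "a > 0"
  shows "E (first_above E a) \<le> a + 1"
proof (cases "first_above E a")
  case 0
  then show ?thesis using E0 assms by simp
next
  case (Suc n)
  then have "E n < a" using first_above_le_iff[of a n] by simp
  then show ?thesis using E_Suc[of n] Suc by simp
qed

lemma E_le: "E n \<le> real n"
proof (induction n)
  case (Suc n)
  then show ?case using E_Suc[of n] by simp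
qed (simp add: E0)

text \<open>Since \<open>E n \<le> real n\<close>, the level \<open>q ^ k\<close> cannot be reached
  before time \<open>q ^ k\<close>.\<close>

lemma filterlim_first_above_power:
  assumes "q > 1"
  shows "filterlim (\<lambda>k. first_above E (q ^ k)) at_top sequentially"
proof -
  have "filterlim (\<lambda>k. real (first_above E (q ^ k))) at_top sequentially"
  proof (rule filterlim_at_top_mono)
    show "filterlim (\<lambda>k. q ^ k) at_top sequentially"
      using assms by (rule filterlim_power_at_top)
    show "\<forall>\<^sub>F k in sequentially. q ^ k \<le> real (first_above E (q ^ k))"
      using first_above_ge E_le order_trans by (intro always_eventually allI) blast
  qed
  then show ?thesis by (simp add: filterlim_sequentially_iff_filterlim_real)
qed

text \<open>Between consecutive passage times both \<open>s\<close> and \<open>E\<close> are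
  monotone, and \<open>E\<close> grows by little more than the factor \<open>q\<close>. Taking the
  mesh and the tolerance both equal to \<open>1 / m\<close> leaves only countably many hypotheses,
  which can hold simultaneously almost surely.\<close>

lemma ratio_tendsto_1:
  fixes s :: "nat \<Rightarrow> real"
  assumes "mono s"
    and sub: "\<And>m::nat. m \<ge> 1 \<Longrightarrow> \<forall>\<^sub>F k in sequentially.
      \<bar>s (first_above E ((1 + 1 / real m) ^ k)) / E (first_above E ((1 + 1 / real m) ^ k)) - 1\<bar>
        \<le> 1 / real m"
  shows "(\<lambda>n. s n / E n) \<longlonglongrightarrow> 1"
proof (rule tendstoI)
  fix e :: real assume "e > 0"
  then obtain m0 where m0: "inverse (real (Suc m0)) < e / 5"
    using reals_Archimedean[of "e / 5"] by auto
  \<comment> \<open>The second \<open>Suc\<close> ensures \<open>m \<ge> 2\<close>, that is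
    \<open>2 * x \<le> 1\<close>.\<close>
  define m where "m = Suc (Suc m0)"
  define x where "x = 1 / real m"
  define q where "q = 1 + x"
  have x: "x > 0" "2 * x \<le> 1" "5 * x < e" "q > 1"
  proof -
    have "x \<le> inverse (real (Suc m0))" by (simp add: x_def m_def field_simps)
    then show "5 * x < e" using m0 by simp
  qed (auto simp: x_def m_def q_def)
  define N where "N k = first_above E (q ^ k)" for k
  have "\<forall>\<^sub>F k in sequentially. \<bar>s (N k) / E (N k) - 1\<bar> \<le> x"
    using sub[of m] by (simp add: N_def q_def x_def m_def)
  \<comment> \<open>From here on the overshoot of at most 1 at a passage time is at most
    \<open>x * q ^ k\<close>.\<close>
  moreover have "\<forall>\<^sub>F k in sequentially. 1 / x \<le> q ^ k"
    using filterlim_power_at_top[OF x(4)] by (simp add: filterlim_at_top)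
  ultimately have "\<forall>\<^sub>F k in sequentially. \<bar>s (N k) / E (N k) - 1\<bar> \<le> x \<and> 1 / x \<le> q ^ k"
    by (rule eventually_conj)
  then obtain K where K: "\<And>k. k \<ge> K \<Longrightarrow> \<bar>s (N k) / E (N k) - 1\<bar> \<le> x" "\<And>k. k \<ge> K \<Longrightarrow> 1 / x \<le> q ^ k"
    unfolding eventually_sequentially by blast
  have sN: "(1 - x) * E (N k) \<le> s (N k)" "s (N k) \<le> (1 + x) * E (N k)" if "k \<ge> K" for k
  proof -
    have "E (N k) > 0"
      using first_above_ge[of "q ^ k"] x by (auto simp: N_def intro: less_le_trans[of 0 "q ^ k"])
    then show "(1 - x) * E (N k) \<le> s (N k)" "s (N k) \<le> (1 + x) * E (N k)"
      using K(1)[OF that] by (auto simp: abs_le_iff field_simps)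
  qed
  have "\<forall>\<^sub>F n in sequentially. q ^ K \<le> E n"
    using E_at_top by (auto simp: filterlim_at_top)
  then show "\<forall>\<^sub>F n in sequentially. dist (s n / E n) 1 < e"
  proof (rule eventually_mono)
    fix n assume n: "q ^ K \<le> E n"
    \<comment> \<open>The predecessor \<open>k\<close> of \<open>j\<close> satisfies
      \<open>q ^ k \<le> E n < q ^ Suc k\<close>, which places \<open>n\<close> between
      \<open>N k\<close> and \<open>N (Suc k)\<close>.\<close>
    define j where "j = (LEAST j. E n < q ^ j)"
    have j: "E n < q ^ j"
      unfolding j_def using real_arch_pow[OF x(4), of "E n"] by (rule LeastI_ex)
    have "K < j"
    proof (rule ccontr)
      assume "\<not> K < j"
      then have "q ^ j \<le> q ^ K" using x by (intro power_increasing) auto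
      with j n show False by simp
    qed
    then obtain k where k: "j = Suc k" "K \<le> k" by (cases j) auto
    have kn: "q ^ k \<le> E n"
      using not_less_Least[of k "\<lambda>j. E n < q ^ j"] k by (simp add: j_def)
    have qk: "q ^ k > 0" using x by simp
    have En: "E n > 0" using kn qk by linarith
    have "N k \<le> n" using kn by (simp add: N_def first_above_le_iff)
    then have "s (N k) \<le> s n" using \<open>mono s\<close> by (rule monoD[rotated])
    moreover have "n \<le> N (Suc k)"
      using j k first_above_le_iff[of "q ^ Suc k" n] by (simp add: N_def)
    then have "s n \<le> s (N (Suc k))" using \<open>mono s\<close> by (rule monoD[rotated])
    ultimately have sn: "(1 - x) * E (N k) \<le> s n" "s n \<le> (1 + x) * E (N (Suc k))"
      using sN[of k] sN[of "Suc k"] k by auto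
    have "(1 + x) * E (N (Suc k)) \<le> (1 + x) * (q * q ^ k + x * q ^ k)"
    proof (rule mult_left_mono)
      have "1 \<le> x * q ^ k" using K(2)[of k] k x by (simp add: field_simps)
      then show "E (N (Suc k)) \<le> q * q ^ k + x * q ^ k"
        using E_first_above_le[of "q ^ Suc k"] x by (simp add: N_def)
    qed (use x in simp)
    also have "\<dots> = ((1 + x) * (1 + 2 * x)) * q ^ k" by (simp add: q_def algebra_simps)
    also have "\<dots> \<le> (1 + 5 * x) * q ^ k"
    proof (rule mult_right_mono)
      have "x * (2 * x) \<le> x * 1" using x by (intro mult_left_mono) auto
      then show "(1 + x) * (1 + 2 * x) \<le> 1 + 5 * x" using x by (simp add: algebra_simps)
    qed (use qk in simp)
    also have "\<dots> \<le> (1 + 5 * x) * E n" using kn x by (intro mult_left_mono) auto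
    also have "\<dots> < (1 + e) * E n" using x En by (intro mult_strict_right_mono) auto
    finally have up: "s n < (1 + e) * E n" using sn by linarith
    \<comment> \<open>The loss of a factor \<open>q\<close> below is covered by
      \<open>(1 - 2 * x) * (1 + x) \<le> 1 - x\<close>.\<close>
    have "(1 - e) * E n < (1 - 2 * x) * E n" using x En by (intro mult_strict_right_mono) auto
    also have "\<dots> \<le> (1 - 2 * x) * (q * q ^ k)" using j k x by (intro mult_left_mono) auto
    also have "\<dots> = ((1 - 2 * x) * q) * q ^ k" by simp
    also have "\<dots> \<le> (1 - x) * q ^ k"
      using x qk by (intro mult_right_mono) (auto simp: q_def algebra_simps)
    also have "\<dots> \<le> (1 - x) * E (N k)"
      using first_above_ge[of "q ^ k"] x by (intro mult_left_mono) (auto simp: N_def)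
    finally have "(1 - e) * E n < s n" using sn by linarith
    with up show "dist (s n / E n) 1 < e"
      using En by (simp add: dist_real_def abs_less_iff field_simps)
  qed
qed

text \<open>Up to a constant, the terms are the Chebyshev bounds for the deviation probabilities at
  the passage times, so this is the input to Borel--Cantelli.\<close>

lemma summable_first_above:
  assumes "\<beta> > 0" "\<gamma> > 1" "q > 1"
    and growth: "\<forall>\<^sub>F n in sequentially.
      E n \<ge> ln (real n) powr \<beta> * ln (ln (real n)) * ln (ln (ln (real n))) powr \<gamma>"
  shows "summable (\<lambda>k. ln (real (first_above E (q ^ k))) powr \<beta> / E (first_above E (q ^ k)))"
proof -
  define N where "N k = first_above E (q ^ k)" for k
  \<comment> \<open>In \<open>q ^ k = p ^ k * p ^ k\<close> one factor pays for the numerator and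
    the other leaves a geometric term. The constant \<open>\<kappa>\<close> is the slope in
    \<open>k\<close> obtained by taking logarithms in \<open>p ^ k < L powr \<beta>\<close>.\<close>
  define p where "p = sqrt q"
  define \<kappa> where "\<kappa> = ln p / \<beta>"
  have p: "p > 1" "p * p = q" using assms by (auto simp: p_def)
  have \<kappa>: "\<kappa> > 0" using p assms by (simp add: \<kappa>_def)
  have ev: "\<forall>\<^sub>F k in sequentially. P (N k)" if "\<forall>\<^sub>F n in sequentially. P n" for P
    using filterlim_first_above_power[OF \<open>q > 1\<close>] that unfolding N_def filterlim_iff by blast
  have "\<forall>\<^sub>F k in sequentially. 1 / \<kappa>\<^sup>2 \<le> real k"
    using filterlim_real_sequentially by (auto simp: filterlim_at_top)
  moreover have "\<forall>\<^sub>F k in sequentially. 3 \<le> N k"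
    by (rule ev) (rule eventually_ge_at_top)
  moreover note ev[OF growth] eventually_ge_at_top[of 2]
  ultimately have "\<forall>\<^sub>F k in sequentially. norm (ln (real (N k)) powr \<beta> / E (N k))
      \<le> (1 / p) ^ k + 2 powr \<gamma> / \<kappa> * inverse (real k * ln (real k) powr \<gamma>)"
  proof eventually_elim
    case (elim k)
    define L where "L = ln (real (N k))"
    have "L \<ge> 1"
      using elim exp_le ln_ge_iff[of "real (N k)" 1] by (auto simp: L_def)
    have E: "q ^ k \<le> E (N k)" using first_above_ge by (simp add: N_def)
    have qk: "q ^ k = p ^ k * p ^ k" using p by (simp flip: power_mult_distrib)
    have pk: "p ^ k > 0" using p by simp
    have Epos: "E (N k) > 0" using E qk pk by (auto intro: less_le_trans[OF mult_pos_pos])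
    have norm: "norm (L powr \<beta> / E (N k)) = L powr \<beta> / E (N k)" using Epos by simp
    have k0: "real k > 1" "ln (real k) > 0" using elim by auto
    \<comment> \<open>If \<open>L powr \<beta>\<close> is large then \<open>ln L\<close> is at least linear in \<open>k\<close>, and the growth of \<open>E\<close> applies.\<close>
    show ?case unfolding L_def[symmetric] norm
    proof (cases "L powr \<beta> \<le> p ^ k")
      case True
      then have "L powr \<beta> / E (N k) \<le> p ^ k / (p ^ k * p ^ k)"
        using E qk pk by (intro frac_le) auto
      also have "\<dots> = (1 / p) ^ k" using pk by (simp add: power_one_over field_simps)
      finally show "L powr \<beta> / E (N k) \<le> (1 / p) ^ k + 2 powr \<gamma> / \<kappa> * inverse (real k * ln (real k) powr \<gamma>)"
        using \<kappa> k0 by (intro add_increasing2) auto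
    next
      case False
      then have "ln (p ^ k) < ln (L powr \<beta>)" using pk \<open>L \<ge> 1\<close> by (subst ln_less_cancel_iff) auto
      then have 1: "\<kappa> * real k < ln L"
        using p \<open>L \<ge> 1\<close> assms by (simp add: ln_realpow ln_powr \<kappa>_def field_simps)
      \<comment> \<open>Passing to the square root avoids the possibly negative
        \<open>ln \<kappa>\<close> in the next logarithm, at the price of the factor
        \<open>2 powr \<gamma>\<close>.\<close>
      have "sqrt (real k) \<le> \<kappa> * real k"
      proof -
        have "1 \<le> \<kappa>\<^sup>2 * real k" using elim \<kappa> by (simp add: field_simps)
        then have "real k \<le> (\<kappa> * real k)\<^sup>2"
          using k0 mult_right_mono[of 1 "\<kappa>\<^sup>2 * real k" "real k"] by (simp add: power2_eq_square algebra_simps)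
        then show ?thesis using \<kappa> by (intro real_le_lsqrt) auto
      qed
      then have "sqrt (real k) \<le> ln L" using 1 by linarith
      then have "ln (sqrt (real k)) \<le> ln (ln L)" using k0 by (intro ln_mono) auto
      then have 2: "ln (real k) / 2 \<le> ln (ln L)" using k0 by (simp add: ln_sqrt)
      have "L powr \<beta> * (\<kappa> * real k) * (ln (real k) / 2) powr \<gamma> \<le> L powr \<beta> * ln L * ln (ln L) powr \<gamma>"
        using 1 2 k0 \<kappa> assms \<open>L \<ge> 1\<close> by (intro mult_mono powr_mono2) auto
      also have "\<dots> \<le> E (N k)" using elim by (simp add: L_def)
      finally have "L powr \<beta> / E (N k) \<le> 2 powr \<gamma> / \<kappa> * inverse (real k * ln (real k) powr \<gamma>)"
        using Epos \<kappa> k0 by (simp add: powr_divide field_simps)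
      then show "L powr \<beta> / E (N k) \<le> (1 / p) ^ k + 2 powr \<gamma> / \<kappa> * inverse (real k * ln (real k) powr \<gamma>)"
        using p by (intro add_increasing) auto
    qed
  qed
  moreover have "summable (\<lambda>k. (1 / p) ^ k + 2 powr \<gamma> / \<kappa> * inverse (real k * ln (real k) powr \<gamma>))"
    using p assms(2) by (intro summable_add summable_mult summable_inverse_ln_powr summable_geometric) auto
  ultimately show ?thesis
    unfolding N_def by (rule summable_comparison_test_ev)
qed

end

section \<open>Strong Borel--Cantelli property\<close>

text \<open>The outer factors are eventually at least 1, so the middle one is a lower bound. Hence
  the growth hypothesis forces the measures of the balls to have infinite sum.\<close>

lemma filterlim_iterated_ln_at_top:
  fixes \<beta> \<gamma> :: real
  assumes "\<beta> > 0" "\<gamma> > 0"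
  shows "filterlim (\<lambda>n. ln (real n) powr \<beta> * ln (ln (real n)) * ln (ln (ln (real n))) powr \<gamma>)
    at_top sequentially"
proof -
  have l1: "filterlim (\<lambda>n. ln (real n)) at_top sequentially"
    by (rule filterlim_compose[OF ln_at_top filterlim_real_sequentially])
  have l2: "filterlim (\<lambda>n. ln (ln (real n))) at_top sequentially"
    by (rule filterlim_compose[OF ln_at_top l1])
  have l3: "filterlim (\<lambda>n. ln (ln (ln (real n)))) at_top sequentially"
    by (rule filterlim_compose[OF ln_at_top l2])
  have "\<forall>\<^sub>F n in sequentially. 1 \<le> ln (real n)" "\<forall>\<^sub>F n in sequentially. 1 \<le> ln (ln (ln (real n)))"
    "\<forall>\<^sub>F n in sequentially. 0 \<le> ln (ln (real n))"
    using l1 l2 l3 unfolding filterlim_at_top by auto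
  then have "\<forall>\<^sub>F n in sequentially. ln (ln (real n))
     \<le> ln (real n) powr \<beta> * ln (ln (real n)) * ln (ln (ln (real n))) powr \<gamma>"
  proof eventually_elim
    case (elim n)
    have "1 * ln (ln (real n)) * 1
      \<le> ln (real n) powr \<beta> * ln (ln (real n)) * ln (ln (ln (real n))) powr \<gamma>"
      using elim assms by (intro mult_mono ge_one_powr_ge_zero) auto
    then show ?case by simp
  qed
  with l2 show ?thesis by (rule filterlim_at_top_mono)
qed

text \<open>Chebyshev's inequality with the variance bound. One \<open>D\<close> serves all
  \<open>\<epsilon>\<close>; only the threshold for \<open>n\<close> depends on it.\<close>

lemma measure_hit_ratio_deviation_le:
  fixes M :: "'a::metric_space measure" and c :: "nat \<Rightarrow> 'a"
  assumes M: "prob_space M" and sets: "sets M = sets borel"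
    and T: "T \<in> measurable M M" and inv: "distr M M T = M"
    and r: "\<And>i. r i > 0" and B: "\<And>i. B i = ball (c i) (r i)"
    and A: "condition_A_balls M c r" and "\<beta> > 0"
    and decay: "exp_decay_of_correlations (1 / \<beta>) T M"
    and lim: "filterlim (\<lambda>n. \<Sum>i<n. measure M (B i)) at_top sequentially"
  shows "\<exists>D>0. \<forall>\<epsilon>>0. \<forall>\<^sub>F n in sequentially.
    measure M {x \<in> space M. \<bar>hit_ratio M T B n x - 1\<bar> > \<epsilon>}
      \<le> D / \<epsilon>\<^sup>2 * (ln (real n) powr \<beta> / (\<Sum>i<n. measure M (B i)))"
proof -
  interpret prob_space M by fact
  define S :: "nat \<Rightarrow> 'a \<Rightarrow> real" where "S n x = (\<Sum>i<n. indicator (B i) ((T ^^ i) x))" for n x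
  define E where "E n = (\<Sum>i<n. measure M (B i))" for n
  have [measurable]: "B i \<in> events" for i unfolding B sets by simp
  have [measurable]: "(T ^^ i) \<in> measurable M M" for i using T by (rule measurable_compose_n)
  have [measurable]: "S n \<in> borel_measurable M" for n unfolding S_def by measurable
  have S: "0 \<le> S n x" "S n x \<le> real n" for n x
    using sum_bounded_above[of "{..<n}" "\<lambda>i. indicator (B i) ((T ^^ i) x)" "1::real"]
    by (auto simp: S_def intro!: sum_nonneg)
  obtain D where D: "D > 0" "\<forall>\<^sub>F n in sequentially.
    (\<integral>x. (S n x - E n)\<^sup>2 \<partial>M) \<le> D * ln (real n) powr \<beta> * E n"
    using variance_hits_le[OF M sets T inv r B A \<open>\<beta> > 0\<close> decay lim] unfolding S_def E_def by blast
  have "\<forall>\<^sub>F n in sequentially. measure M {x \<in> space M. \<bar>hit_ratio M T B n x - 1\<bar> > \<epsilon>}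
      \<le> D / \<epsilon>\<^sup>2 * (ln (real n) powr \<beta> / E n)" if "\<epsilon> > 0" for \<epsilon>
  proof -
    have "\<forall>\<^sub>F n in sequentially. 1 \<le> E n"
      using lim unfolding E_def filterlim_at_top by blast
    then show ?thesis using D(2)
    proof eventually_elim
      case (elim n)
      have hit: "hit_ratio M T B n x = S n x / E n" for x
        by (simp add: hit_ratio_def S_def E_def)
      have "{x \<in> space M. \<bar>hit_ratio M T B n x - 1\<bar> > \<epsilon>}
        \<subseteq> {x \<in> space M. (\<epsilon> * E n)\<^sup>2 \<le> (S n x - E n)\<^sup>2}"
      proof safe
        fix x assume "\<epsilon> < \<bar>hit_ratio M T B n x - 1\<bar>"
        also have "hit_ratio M T B n x - 1 = (S n x - E n) / E n"
          using elim by (simp add: hit field_simps)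
        finally have "\<epsilon> * E n \<le> \<bar>S n x - E n\<bar>" using elim by (simp add: field_simps)
        then have "(\<epsilon> * E n)\<^sup>2 \<le> \<bar>S n x - E n\<bar>\<^sup>2"
          using that elim by (intro power_mono) auto
        then show "(\<epsilon> * E n)\<^sup>2 \<le> (S n x - E n)\<^sup>2" by simp
      qed
      then have "measure M {x \<in> space M. \<bar>hit_ratio M T B n x - 1\<bar> > \<epsilon>}
        \<le> measure M {x \<in> space M. (\<epsilon> * E n)\<^sup>2 \<le> (S n x - E n)\<^sup>2}"
        by (intro finite_measure_mono) measurable
      also have "\<dots> \<le> (\<integral>x. (S n x - E n)\<^sup>2 \<partial>M) / (\<epsilon> * E n)\<^sup>2"
      proof (rule integral_Markov_inequality_measure)
        have "(S n x - E n)\<^sup>2 \<le> (real n + E n)\<^sup>2" for x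
          using S[of n x] elim by (subst abs_le_square_iff[symmetric]) auto
        then show "integrable M (\<lambda>x. (S n x - E n)\<^sup>2)"
          by (intro integrable_const_bound[of _ "(real n + E n)\<^sup>2"]) auto
      qed (use that elim in auto)
      also have "\<dots> \<le> (D * ln (real n) powr \<beta> * E n) / (\<epsilon> * E n)\<^sup>2"
        using elim by (intro divide_right_mono) auto
      also have "\<dots> = D / \<epsilon>\<^sup>2 * (ln (real n) powr \<beta> / E n)"
        using elim by (simp add: power2_eq_square)
      finally show ?case .
    qed
  qed
  with D(1) show ?thesis unfolding E_def by blast
qed

theorem theorem5:
  fixes M :: "'a::metric_space measure" and T :: "'a \<Rightarrow> 'a"
    and c :: "nat \<Rightarrow> 'a" and r :: "nat \<Rightarrow> real" and B :: "nat \<Rightarrow> 'a set"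
    and \<beta> \<gamma> :: real
  assumes "prob_space M" and "sets M = sets borel"
    and "T \<in> measurable M M" and "distr M M T = M"
    and "\<And>i. r i > 0" and "\<And>i. B i = ball (c i) (r i)"
    and "condition_A_balls M c r"
    and "\<beta> > 0" and "\<gamma> > 1"
    and "\<forall>\<^sub>F n in sequentially. (\<Sum>i<n. measure M (B i)) \<ge>
           ln (real n) powr \<beta> * ln (ln (real n)) * ln (ln (ln (real n))) powr \<gamma>"
    and "exp_decay_of_correlations (1 / \<beta>) T M"
  shows "(AE x in M. (\<lambda>n. hit_ratio M T B n x) \<longlonglongrightarrow> 1) \<and>
         (\<forall>\<epsilon>>0. \<exists>C>0. \<forall>\<^sub>F n in sequentially.
            measure M {x \<in> space M. \<bar>hit_ratio M T B n x - 1\<bar> > \<epsilon>}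
              \<le> C * inverse (ln (ln (real n))) * ln (ln (ln (real n))) powr (- \<gamma>))"
proof -
  interpret prob_space M by fact
  define S :: "nat \<Rightarrow> 'a \<Rightarrow> real" where "S n x = (\<Sum>i<n. indicator (B i) ((T ^^ i) x))" for n x
  define E where "E n = (\<Sum>i<n. measure M (B i))" for n
  define dev where "dev \<epsilon> n = {x \<in> space M. \<bar>hit_ratio M T B n x - 1\<bar> > \<epsilon>}" for \<epsilon> n
  note growth = assms(10)
  have hit: "hit_ratio M T B n x = S n x / E n" for n x
    by (simp add: hit_ratio_def S_def E_def)
  have lim: "filterlim E at_top sequentially"
    using growth assms(8,9) unfolding E_def
    by (intro filterlim_at_top_mono[OF filterlim_iterated_ln_at_top[of \<beta> \<gamma>]]) auto
  interpret E: slowly_divergent E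
    by standard (auto simp: lim E_def intro!: incseq_SucI)
  obtain D where D: "D > 0" "\<And>\<epsilon>. \<epsilon> > 0 \<Longrightarrow> \<forall>\<^sub>F n in sequentially.
      measure M (dev \<epsilon> n) \<le> D / \<epsilon>\<^sup>2 * (ln (real n) powr \<beta> / E n)"
    using measure_hit_ratio_deviation_le[OF assms(1-8,11)] lim unfolding E_def dev_def by blast
  have [measurable]: "B i \<in> events" for i unfolding assms(2,6) by simp
  have [measurable]: "(T ^^ i) \<in> measurable M M" for i using assms(3) by (rule measurable_compose_n)
  have dev_sets: "dev \<epsilon> n \<in> events" for \<epsilon> n
    unfolding dev_def hit_ratio_def by measurable
  have "AE x in M. (\<lambda>n. hit_ratio M T B n x) \<longlonglongrightarrow> 1"
  proof -
    define N where "N m k = first_above E ((1 + 1 / real m) ^ k)" for m k :: nat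
    \<comment> \<open>The exceptional null set depends on \<open>m\<close>, and a countable union of
      these sets is still null.\<close>
    have "AE x in M. \<forall>\<^sub>F k in sequentially. x \<in> space M - dev (1 / real m) (N m k)" if "m \<ge> 1" for m
    proof (rule borel_cantelli_AE1)
      have q: "1 + 1 / real m > 1" using that by simp
      have ev: "\<forall>\<^sub>F k in sequentially. measure M (dev (1 / real m) (N m k))
        \<le> D / (1 / real m)\<^sup>2 * (ln (real (N m k)) powr \<beta> / E (N m k))"
        unfolding N_def using that
        by (intro eventually_compose_filterlim[OF D(2) E.filterlim_first_above_power[OF q]]) simp
      have sm: "summable (\<lambda>k. D / (1 / real m)\<^sup>2 * (ln (real (N m k)) powr \<beta> / E (N m k)))"
        unfolding N_def
        by (rule summable_mult[OF E.summable_first_above[OF assms(8,9) q growth[folded E_def]]])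
      show "summable (\<lambda>k. measure M (dev (1 / real m) (N m k)))"
        by (rule summable_comparison_test_ev[OF _ sm]) (use ev in simp)
    qed (auto simp: dev_sets less_top[symmetric])
    then have "AE x in M. \<forall>m. m \<ge> 1 \<longrightarrow> (\<forall>\<^sub>F k in sequentially. x \<in> space M - dev (1 / real m) (N m k))"
      by (simp add: AE_all_countable)
    then show ?thesis
    proof (rule eventually_mono)
      fix x assume elim: "\<forall>m. m \<ge> 1 \<longrightarrow> (\<forall>\<^sub>F k in sequentially. x \<in> space M - dev (1 / real m) (N m k))"
      show "(\<lambda>n. hit_ratio M T B n x) \<longlonglongrightarrow> 1" unfolding hit
      proof (rule E.ratio_tendsto_1)
        show "mono (\<lambda>n. S n x)" by (intro incseq_SucI) (simp add: S_def)
        fix m :: nat assume "m \<ge> 1"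
        with elim have "\<forall>\<^sub>F k in sequentially. x \<in> space M - dev (1 / real m) (N m k)" by blast
        then show "\<forall>\<^sub>F k in sequentially. \<bar>S (first_above E ((1 + 1 / real m) ^ k)) x /
            E (first_above E ((1 + 1 / real m) ^ k)) - 1\<bar> \<le> 1 / real m"
          by eventually_elim (auto simp: dev_def hit N_def)
      qed
    qed
  qed
  moreover have "\<exists>C>0. \<forall>\<^sub>F n in sequentially. measure M (dev \<epsilon> n)
      \<le> C * inverse (ln (ln (real n))) * ln (ln (ln (real n))) powr (- \<gamma>)" if "\<epsilon> > 0" for \<epsilon>
  proof (intro exI[of _ "D / \<epsilon>\<^sup>2"] conjI)
    show "D / \<epsilon>\<^sup>2 > 0" using D that by simp
    have l2: "filterlim (\<lambda>n. ln (ln (real n))) at_top sequentially"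
      by (intro filterlim_compose[OF ln_at_top] filterlim_real_sequentially)
    \<comment> \<open>Then \<open>ln (ln n)\<close> and \<open>ln (ln (ln n))\<close> are both
      positive, and the growth bound can be inverted.\<close>
    then have "\<forall>\<^sub>F n in sequentially. 1 < ln (ln (real n))"
      by (simp add: filterlim_at_top_dense)
    moreover have "\<forall>\<^sub>F n in sequentially. 0 < E n"
      using lim by (simp add: filterlim_at_top_dense)
    moreover note D(2)[OF that] growth[folded E_def]
    ultimately show "\<forall>\<^sub>F n in sequentially. measure M (dev \<epsilon> n)
      \<le> D / \<epsilon>\<^sup>2 * inverse (ln (ln (real n))) * ln (ln (ln (real n))) powr (- \<gamma>)"
    proof eventually_elim
      case (elim n)
      have pos: "ln (ln (real n)) * ln (ln (ln (real n))) powr \<gamma> > 0"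
        using elim by simp
      have "ln (real n) powr \<beta> / E n \<le> 1 / (ln (ln (real n)) * ln (ln (ln (real n))) powr \<gamma>)"
        using elim pos by (simp add: field_simps)
      then have "D / \<epsilon>\<^sup>2 * (ln (real n) powr \<beta> / E n)
        \<le> D / \<epsilon>\<^sup>2 * (1 / (ln (ln (real n)) * ln (ln (ln (real n))) powr \<gamma>))"
        using D by (intro mult_left_mono) auto
      also have "\<dots> = D / \<epsilon>\<^sup>2 * inverse (ln (ln (real n))) * ln (ln (ln (real n))) powr (- \<gamma>)"
        by (simp add: powr_minus field_simps)
      finally show ?case using elim by linarith
    qed
  qed
  ultimately show ?thesis unfolding dev_def by blast
qed

end
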